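(* Let $(\mathcal{C},\times)$ be a cartesian monoidal category. For each object $X$ of $\mathcal{C}$ let $\pi_1,\pi_2\colon X^2\to X$ be the projections and $\tau=(\pi_2,\pi_1)\colon X^2\to X^2$. Let $F$ be the assignment that sends each rack object $(X,\triangleright,\triangleright^{-1})$ in $\mathcal{C}$ to the pair $(X,r)$, where $$r:=(\pi_1,\triangleright)\circ\tau\colon X^2\to X^2,$$ and that sends each morphism to itself. Then $F$ is a fully faithful functor from the category $\mathsf{Rack}(\mathcal{C})$ of rack objects in $\mathcal{C}$ to the category $\mathsf{YB}^{\mathrm{nd}}(\mathcal{C})$ of nondegenerate Yang–Baxter operators in $\mathcal{C}$.
   Context: A rack object in $\mathcal{C}$ is an object $X$ with morphisms $\triangleright,\triangleright^{-1}\colon X^2\to X$ such that: (i) $(\triangleright,\pi_1)$ and $(\pi_2,\triangleright^{-1})\colon X^2\to X^2$ are mutually inverse; (ii) $\triangleright\circ(\mathrm{id}\times\triangleright)=\triangleright\circ(\mathrm{id}\times\triangleright)\circ((\triangleright,\pi_1)\times\mathrm{id})$ as morphisms $X^3\to X$; (iii) $\triangleright^{-1}\circ(\triangleright^{-1}\times\mathrm{id})=\triangleright^{-1}\circ(\triangleright^{-1}\times\mathrm{id})\circ(\mathrm{id}\times(\pi_2,\triangleright^{-1}))$ as morphisms $X^3\to X$. (On elements: $(x\triangleright y)\triangleright^{-1}x=y=x\triangleright(y\triangleright^{-1}x)$, $x\triangleright(y\triangleright z)=(x\triangleright y)\triangleright(x\triangleright z)$, $(x\triangleright^{-1}y)\triangleright^{-1}z=(x\triangleright^{-1}z)\triangleright^{-1}(y\triangleright^{-1}z)$.)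 A morphism of rack objects is a morphism $\varphi\colon X\to Y$ in $\mathcal{C}$ with $\varphi\circ\triangleright_X=\triangleright_Y\circ(\varphi\times\varphi)$ and $\varphi\circ\triangleright_X^{-1}=\triangleright_Y^{-1}\circ(\varphi\times\varphi)$. A Yang–Baxter operator in $\mathcal{C}$ is a pair $(X,r)$ with $X$ an object and $r\in\operatorname{Aut}(X^2)$ satisfying $(r\times\mathrm{id})(\mathrm{id}\times r)(r\times\mathrm{id})=(\mathrm{id}\times r)(r\times\mathrm{id})(\mathrm{id}\times r)$ on $X^3$. It is nondegenerate if the endomorphisms $r_1:=(\pi_1,\pi_1\circ r)$ and $r_2:=(\pi_2\circ r,\pi_2)$ of $X^2$ are invertible. A morphism $(X,r)\to(Y,s)$ is a morphism $\varphi\colon X\to Y$ in $\mathcal{C}$ with $(\varphi\times\varphi)\circ r=s\circ(\varphi\times\varphi)$. $\mathsf{YB}^{\mathrm{nd}}(\mathcal{C})$ is the full subcategory of nondegenerate objects in the resulting category of Yang–Baxter operators. *)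

theory Defs
  imports Main
begin

section \<open>Categories and functors\<close>

record ('o, 'm) category =
  Obj :: "'o set"
  Arr :: "'m set"
  Dom :: "'m \<Rightarrow> 'o"
  Cod :: "'m \<Rightarrow> 'o"
  Ident :: "'o \<Rightarrow> 'm"
  Comp :: "'m \<Rightarrow> 'm \<Rightarrow> 'm"  (infixr \<open>\<cdot>\<index>\<close> 55)

definition hom :: "('o, 'm, 'z) category_scheme \<Rightarrow> 'o \<Rightarrow> 'o \<Rightarrow> 'm set" where
  "hom C A B = {f \<in> Arr C. Dom C f = A \<and> Cod C f = B}"

locale category =
  fixes C :: "('o, 'm, 'z) category_scheme" (structure)
  assumes Dom_in_Obj: "f \<in> Arr C \<Longrightarrow> Dom C f \<in> Obj C"
    and Cod_in_Obj: "f \<in> Arr C \<Longrightarrow> Cod C f \<in> Obj C"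
    and Ident_in_hom: "A \<in> Obj C \<Longrightarrow> Ident C A \<in> hom C A A"
    and Comp_in_hom: "\<lbrakk>f \<in> hom C A B; g \<in> hom C B D\<rbrakk> \<Longrightarrow> g \<cdot> f \<in> hom C A D"
    and Comp_Ident: "f \<in> hom C A B \<Longrightarrow> f \<cdot> Ident C A = f"
    and Ident_Comp: "f \<in> hom C A B \<Longrightarrow> Ident C B \<cdot> f = f"
    and Comp_assoc: "\<lbrakk>f \<in> hom C A B; g \<in> hom C B D; h \<in> hom C D E\<rbrakk> \<Longrightarrow> (h \<cdot> g) \<cdot> f = h \<cdot> g \<cdot> f"

definition inverse_arrows :: "('o, 'm, 'z) category_scheme \<Rightarrow> 'm \<Rightarrow> 'm \<Rightarrow> bool" where
  "inverse_arrows C f g \<longleftrightarrow>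
     f \<in> Arr C \<and> g \<in> hom C (Cod C f) (Dom C f) \<and>
     g \<cdot>\<^bsub>C\<^esub> f = Ident C (Dom C f) \<and> f \<cdot>\<^bsub>C\<^esub> g = Ident C (Cod C f)"

definition invertible :: "('o, 'm, 'z) category_scheme \<Rightarrow> 'm \<Rightarrow> bool" where
  "invertible C f \<longleftrightarrow> (\<exists>g. inverse_arrows C f g)"

definition Aut :: "('o, 'm, 'z) category_scheme \<Rightarrow> 'o \<Rightarrow> 'm set" where
  "Aut C A = {f \<in> hom C A A. invertible C f}"

definition full_subcategory ::
    "('o, 'm) category \<Rightarrow> ('o \<Rightarrow> bool) \<Rightarrow> ('o, 'm) category" where
  "full_subcategory C P =
     C\<lparr>Obj := {A \<in> Obj C. P A}, Arr := {f \<in> Arr C. P (Dom C f) \<and> P (Cod C f)}\<rparr>"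

locale category_functor = source: category C + target: category D
  for C :: "('o, 'm, 'z) category_scheme" and D :: "('p, 'n, 'y) category_scheme" +
  fixes Fo :: "'o \<Rightarrow> 'p" and Fm :: "'m \<Rightarrow> 'n"
  assumes Fo_in_Obj: "A \<in> Obj C \<Longrightarrow> Fo A \<in> Obj D"
    and Fm_in_hom: "f \<in> hom C A B \<Longrightarrow> Fm f \<in> hom D (Fo A) (Fo B)"
    and Fm_Ident: "A \<in> Obj C \<Longrightarrow> Fm (Ident C A) = Ident D (Fo A)"
    and Fm_Comp: "\<lbrakk>f \<in> hom C A B; g \<in> hom C B E\<rbrakk> \<Longrightarrow> Fm (g \<cdot>\<^bsub>C\<^esub> f) = Fm g \<cdot>\<^bsub>D\<^esub> Fm f"

locale fully_faithful_functor = category_functor C D Fo Fm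
  for C :: "('o, 'm, 'z) category_scheme" and D :: "('p, 'n, 'y) category_scheme"
    and Fo :: "'o \<Rightarrow> 'p" and Fm :: "'m \<Rightarrow> 'n" +
  assumes full:
      "\<lbrakk>A \<in> Obj C; B \<in> Obj C; g \<in> hom D (Fo A) (Fo B)\<rbrakk> \<Longrightarrow> \<exists>f \<in> hom C A B. Fm f = g"
    and faithful:
      "\<lbrakk>A \<in> Obj C; B \<in> Obj C; f \<in> hom C A B; f' \<in> hom C A B; Fm f = Fm f'\<rbrakk> \<Longrightarrow> f = f'"


section \<open>Cartesian monoidal categories\<close>

text \<open>
  A cartesian monoidal category is a category with chosen finite products (a terminal object and
  binary products with projections). The remaining monoidal structure is the one induced by the
  universal properties; the parts of it that are used below are the tensor product of arrows and
  the associator.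
\<close>

record ('o, 'm) cartesian = "('o, 'm) category" +
  Unit :: "'o"
  Prod :: "'o \<Rightarrow> 'o \<Rightarrow> 'o"  (infixr \<open>\<otimes>\<index>\<close> 70)
  Proj1 :: "'o \<Rightarrow> 'o \<Rightarrow> 'm"  (\<open>\<pi>\<^sub>1\<index>\<close>)
  Proj2 :: "'o \<Rightarrow> 'o \<Rightarrow> 'm"  (\<open>\<pi>\<^sub>2\<index>\<close>)

locale cartesian_monoidal_category = category C
  for C :: "('o, 'm, 'z) cartesian_scheme" (structure) +
  assumes Unit_in_Obj: "Unit C \<in> Obj C"
    and Unit_terminal: "A \<in> Obj C \<Longrightarrow> \<exists>!f. f \<in> hom C A (Unit C)"
    and Prod_in_Obj: "\<lbrakk>A \<in> Obj C; B \<in> Obj C\<rbrakk> \<Longrightarrow> A \<otimes> B \<in> Obj C"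
    and Proj1_in_hom: "\<lbrakk>A \<in> Obj C; B \<in> Obj C\<rbrakk> \<Longrightarrow> \<pi>\<^sub>1 A B \<in> hom C (A \<otimes> B) A"
    and Proj2_in_hom: "\<lbrakk>A \<in> Obj C; B \<in> Obj C\<rbrakk> \<Longrightarrow> \<pi>\<^sub>2 A B \<in> hom C (A \<otimes> B) B"
    and Prod_universal:
      "\<lbrakk>f \<in> hom C Z A; g \<in> hom C Z B\<rbrakk> \<Longrightarrow>
         \<exists>!h. h \<in> hom C Z (A \<otimes> B) \<and> \<pi>\<^sub>1 A B \<cdot> h = f \<and> \<pi>\<^sub>2 A B \<cdot> h = g"

definition Pairing :: "('o, 'm, 'z) cartesian_scheme \<Rightarrow> 'm \<Rightarrow> 'm \<Rightarrow> 'm"  (\<open>\<langle>_, _\<rangle>\<index>\<close>) where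
  "\<langle>f, g\<rangle>\<^bsub>C\<^esub> =
     (THE h. h \<in> hom C (Dom C f) (Cod C f \<otimes>\<^bsub>C\<^esub> Cod C g) \<and>
        \<pi>\<^sub>1\<^bsub>C\<^esub> (Cod C f) (Cod C g) \<cdot>\<^bsub>C\<^esub> h = f \<and>
        \<pi>\<^sub>2\<^bsub>C\<^esub> (Cod C f) (Cod C g) \<cdot>\<^bsub>C\<^esub> h = g)"

definition Tensor :: "('o, 'm, 'z) cartesian_scheme \<Rightarrow> 'm \<Rightarrow> 'm \<Rightarrow> 'm"
    (infixr \<open>\<boxtimes>\<index>\<close> 70) where
  "f \<boxtimes>\<^bsub>C\<^esub> g =
     \<langle>f \<cdot>\<^bsub>C\<^esub> \<pi>\<^sub>1\<^bsub>C\<^esub> (Dom C f) (Dom C g), g \<cdot>\<^bsub>C\<^esub> \<pi>\<^sub>2\<^bsub>C\<^esub> (Dom C f) (Dom C g)\<rangle>\<^bsub>C\<^esub>"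

definition Swap :: "('o, 'm, 'z) cartesian_scheme \<Rightarrow> 'o \<Rightarrow> 'm"  (\<open>\<tau>\<index>\<close>) where
  "\<tau>\<^bsub>C\<^esub> X = \<langle>\<pi>\<^sub>2\<^bsub>C\<^esub> X X, \<pi>\<^sub>1\<^bsub>C\<^esub> X X\<rangle>\<^bsub>C\<^esub>"

text \<open>
  Throughout, \<open>X\<^sup>3\<close> is read as \<open>(X \<otimes> X) \<otimes> X\<close>, and \<open>\<alpha> X\<close> is the associator
  \<open>(X \<otimes> X) \<otimes> X \<rightarrow> X \<otimes> (X \<otimes> X)\<close> with inverse \<open>\<alpha>' X\<close>. So an arrow \<open>f \<times> id\<close> out of \<open>X\<^sup>3\<close>
  is \<open>f \<boxtimes> Ident X\<close>, and \<open>id \<times> f\<close> is \<open>Ident X \<boxtimes> f\<close> precomposed with \<open>\<alpha> X\<close> (and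
  postcomposed with \<open>\<alpha>' X\<close> if its codomain is again \<open>X\<^sup>3\<close>).
\<close>

definition Assoc :: "('o, 'm, 'z) cartesian_scheme \<Rightarrow> 'o \<Rightarrow> 'm"  (\<open>\<alpha>\<index>\<close>) where
  "\<alpha>\<^bsub>C\<^esub> X =
     \<langle>\<pi>\<^sub>1\<^bsub>C\<^esub> X X \<cdot>\<^bsub>C\<^esub> \<pi>\<^sub>1\<^bsub>C\<^esub> (X \<otimes>\<^bsub>C\<^esub> X) X,
      \<langle>\<pi>\<^sub>2\<^bsub>C\<^esub> X X \<cdot>\<^bsub>C\<^esub> \<pi>\<^sub>1\<^bsub>C\<^esub> (X \<otimes>\<^bsub>C\<^esub> X) X, \<pi>\<^sub>2\<^bsub>C\<^esub> (X \<otimes>\<^bsub>C\<^esub> X) X\<rangle>\<^bsub>C\<^esub>\<rangle>\<^bsub>C\<^esub>"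

definition Assoc_inv :: "('o, 'm, 'z) cartesian_scheme \<Rightarrow> 'o \<Rightarrow> 'm"  (\<open>\<alpha>''\<index>\<close>) where
  "\<alpha>'\<^bsub>C\<^esub> X =
     \<langle>\<langle>\<pi>\<^sub>1\<^bsub>C\<^esub> X (X \<otimes>\<^bsub>C\<^esub> X), \<pi>\<^sub>1\<^bsub>C\<^esub> X X \<cdot>\<^bsub>C\<^esub> \<pi>\<^sub>2\<^bsub>C\<^esub> X (X \<otimes>\<^bsub>C\<^esub> X)\<rangle>\<^bsub>C\<^esub>,
      \<pi>\<^sub>2\<^bsub>C\<^esub> X X \<cdot>\<^bsub>C\<^esub> \<pi>\<^sub>2\<^bsub>C\<^esub> X (X \<otimes>\<^bsub>C\<^esub> X)\<rangle>\<^bsub>C\<^esub>"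


section \<open>Rack objects\<close>

text \<open>\<open>t\<close> and \<open>u\<close> stand for \<open>\<triangleright>\<close> and \<open>\<triangleright>\<^sup>-\<^sup>1\<close>.\<close>

locale rack_object = cartesian_monoidal_category C
  for C :: "('o, 'm, 'z) cartesian_scheme" (structure)
    and X :: 'o and t :: 'm and u :: 'm +
  assumes carrier_in_Obj: "X \<in> Obj C"
    and t_in_hom: "t \<in> hom C (X \<otimes> X) X"
    and u_in_hom: "u \<in> hom C (X \<otimes> X) X"
    and mutually_inverse: "inverse_arrows C \<langle>t, \<pi>\<^sub>1 X X\<rangle> \<langle>\<pi>\<^sub>2 X X, u\<rangle>"
    and t_self_distributive:
      "t \<cdot> (Ident C X \<boxtimes> t) \<cdot> \<alpha> X =
       t \<cdot> (Ident C X \<boxtimes> t) \<cdot> \<alpha> X \<cdot> (\<langle>t, \<pi>\<^sub>1 X X\<rangle> \<boxtimes> Ident C X)"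
    and u_self_distributive:
      "u \<cdot> (u \<boxtimes> Ident C X) =
       u \<cdot> (u \<boxtimes> Ident C X) \<cdot> \<alpha>' X \<cdot> (Ident C X \<boxtimes> \<langle>\<pi>\<^sub>2 X X, u\<rangle>) \<cdot> \<alpha> X"

locale rack_morphism =
  source: rack_object C X t u + target: rack_object C Y t' u'
  for C :: "('o, 'm, 'z) cartesian_scheme" (structure)
    and X t u Y t' u' +
  fixes \<phi> :: 'm
  assumes \<phi>_in_hom: "\<phi> \<in> hom C X Y"
    and \<phi>_t: "\<phi> \<cdot> t = t' \<cdot> (\<phi> \<boxtimes> \<phi>)"
    and \<phi>_u: "\<phi> \<cdot> u = u' \<cdot> (\<phi> \<boxtimes> \<phi>)"

text \<open>
  The same arrow of \<open>C\<close> can be a morphism between different rack structures on the same objects,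
  so the arrows of the category of rack objects record their source and target. The category of
  Yang--Baxter operators is built in the same way.
\<close>

definition Rack :: "('o, 'm, 'z) cartesian_scheme \<Rightarrow>
    ('o \<times> 'm \<times> 'm, ('o \<times> 'm \<times> 'm) \<times> 'm \<times> ('o \<times> 'm \<times> 'm)) category" where
  "Rack C =
     \<lparr>Obj = {(X, t, u). rack_object C X t u},
      Arr = {((X, t, u), \<phi>, (Y, t', u')). rack_morphism C X t u Y t' u' \<phi>},
      Dom = (\<lambda>(S, \<phi>, T). S),
      Cod = (\<lambda>(S, \<phi>, T). T),
      Ident = (\<lambda>(X, t, u). ((X, t, u), Ident C X, (X, t, u))),
      Comp = (\<lambda>(S', \<psi>, T') (S, \<phi>, T). (S, \<psi> \<cdot>\<^bsub>C\<^esub> \<phi>, T'))\<rparr>"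


section \<open>Yang--Baxter operators\<close>

locale yang_baxter_operator = cartesian_monoidal_category C
  for C :: "('o, 'm, 'z) cartesian_scheme" (structure)
    and X :: 'o and r :: 'm +
  assumes carrier_in_Obj: "X \<in> Obj C"
    and r_in_Aut: "r \<in> Aut C (X \<otimes> X)"
    and yang_baxter:
      "(r \<boxtimes> Ident C X) \<cdot> (\<alpha>' X \<cdot> (Ident C X \<boxtimes> r) \<cdot> \<alpha> X) \<cdot> (r \<boxtimes> Ident C X) =
       (\<alpha>' X \<cdot> (Ident C X \<boxtimes> r) \<cdot> \<alpha> X) \<cdot> (r \<boxtimes> Ident C X) \<cdot> (\<alpha>' X \<cdot> (Ident C X \<boxtimes> r) \<cdot> \<alpha> X)"

definition nondegenerate :: "('o, 'm, 'z) cartesian_scheme \<Rightarrow> 'o \<Rightarrow> 'm \<Rightarrow> bool" where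
  "nondegenerate C X r \<longleftrightarrow>
     invertible C \<langle>\<pi>\<^sub>1\<^bsub>C\<^esub> X X, \<pi>\<^sub>1\<^bsub>C\<^esub> X X \<cdot>\<^bsub>C\<^esub> r\<rangle>\<^bsub>C\<^esub> \<and>
     invertible C \<langle>\<pi>\<^sub>2\<^bsub>C\<^esub> X X \<cdot>\<^bsub>C\<^esub> r, \<pi>\<^sub>2\<^bsub>C\<^esub> X X\<rangle>\<^bsub>C\<^esub>"

locale yang_baxter_morphism =
  source: yang_baxter_operator C X r + target: yang_baxter_operator C Y s
  for C :: "('o, 'm, 'z) cartesian_scheme" (structure)
    and X r Y s +
  fixes \<phi> :: 'm
  assumes \<phi>_in_hom: "\<phi> \<in> hom C X Y"
    and \<phi>_r: "(\<phi> \<boxtimes> \<phi>) \<cdot> r = s \<cdot> (\<phi> \<boxtimes> \<phi>)"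

definition YB :: "('o, 'm, 'z) cartesian_scheme \<Rightarrow>
    ('o \<times> 'm, ('o \<times> 'm) \<times> 'm \<times> ('o \<times> 'm)) category" where
  "YB C =
     \<lparr>Obj = {(X, r). yang_baxter_operator C X r},
      Arr = {((X, r), \<phi>, (Y, s)). yang_baxter_morphism C X r Y s \<phi>},
      Dom = (\<lambda>(S, \<phi>, T). S),
      Cod = (\<lambda>(S, \<phi>, T). T),
      Ident = (\<lambda>(X, r). ((X, r), Ident C X, (X, r))),
      Comp = (\<lambda>(S', \<psi>, T') (S, \<phi>, T). (S, \<psi> \<cdot>\<^bsub>C\<^esub> \<phi>, T'))\<rparr>"

definition YB_nd :: "('o, 'm, 'z) cartesian_scheme \<Rightarrow>
    ('o \<times> 'm, ('o \<times> 'm) \<times> 'm \<times> ('o \<times> 'm)) category" where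
  "YB_nd C = full_subcategory (YB C) (\<lambda>(X, r). nondegenerate C X r)"


section \<open>The assignment F\<close>

definition F_obj :: "('o, 'm, 'z) cartesian_scheme \<Rightarrow> 'o \<times> 'm \<times> 'm \<Rightarrow> 'o \<times> 'm" where
  "F_obj C = (\<lambda>(X, t, u). (X, \<langle>\<pi>\<^sub>1\<^bsub>C\<^esub> X X, t\<rangle>\<^bsub>C\<^esub> \<cdot>\<^bsub>C\<^esub> \<tau>\<^bsub>C\<^esub> X))"

definition F_arr :: "('o, 'm, 'z) cartesian_scheme \<Rightarrow>
    ('o \<times> 'm \<times> 'm) \<times> 'm \<times> ('o \<times> 'm \<times> 'm) \<Rightarrow> ('o \<times> 'm) \<times> 'm \<times> ('o \<times> 'm)" where
  "F_arr C = (\<lambda>(S, \<phi>, T). (F_obj C S, \<phi>, F_obj C T))"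

end

theory Submission
  imports Defs
begin

text \<open>
  In a cartesian monoidal category an equation between arrows out of \<open>X\<^sup>2\<close> or \<open>X\<^sup>3\<close> may be tested
  on generalized elements \<open>x, y, z : Z \<rightarrow> X\<close> (\<open>arrow_from_square_eqI\<close>, \<open>arrow_from_cube_eqI\<close>), so
  that everything reduces to the set-theoretic computation with \<open>r(x, y) = (y, y \<triangleright> x)\<close>.

  This \<open>r\<close> is invertible because \<open>x\<close> can be recovered from \<open>y\<close> and \<open>y \<triangleright> x\<close> by \<open>\<triangleright>\<^sup>-\<^sup>1\<close>; the braid
  relation for it is left self-distributivity of \<open>\<triangleright>\<close>. Of the two maps in the definition of
  nondegeneracy, one is the identity and the other is \<open>(x, y) \<mapsto> (y \<triangleright> x, y)\<close>, which is again
  inverted by means of \<open>\<triangleright>\<^sup>-\<^sup>1\<close>.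

  Faithfulness holds because the functor does not change the underlying arrow. For fullness, an
  arrow that commutes with the operators commutes with \<open>\<triangleright>\<close>, which is the second component of
  \<open>r\<close>, and therefore also with \<open>\<triangleright>\<^sup>-\<^sup>1\<close>, which is determined by \<open>\<triangleright>\<close>. This is
  \<open>rack_morphism_iff_yang_baxter_morphism\<close>; its forward direction says that the functor is
  well defined on arrows.
\<close>

section \<open>Calculating with arrows and generalized elements\<close>

text \<open>
  The category axioms are restated with separate equations for domains and codomains in place of
  \<open>hom\<close>. Their conditions then mention only arrows present in the left-hand side, so that the
  simplifier can discharge them, and composites reassociate to the right automatically.
\<close>

context category
begin

lemma Comp_type [simp]:
  assumes "f \<in> Arr C" "g \<in> Arr C" "Cod C f = Dom C g"
  shows "g \<cdot> f \<in> Arr C" "Dom C (g \<cdot> f) = Dom C f" "Cod C (g \<cdot> f) = Cod C g"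
  using Comp_in_hom[of f "Dom C f" "Cod C f" g "Cod C g"] assms by (auto simp: hom_def)

lemma Ident_type [simp]:
  assumes "A \<in> Obj C"
  shows "Ident C A \<in> Arr C" "Dom C (Ident C A) = A" "Cod C (Ident C A) = A"
  using Ident_in_hom[OF assms] by (auto simp: hom_def)

lemma Comp_Ident_right [simp]: "f \<in> Arr C \<Longrightarrow> Dom C f = A \<Longrightarrow> f \<cdot> Ident C A = f"
  using Comp_Ident[of f A "Cod C f"] by (simp add: hom_def)

lemma Comp_Ident_left [simp]: "f \<in> Arr C \<Longrightarrow> Cod C f = B \<Longrightarrow> Ident C B \<cdot> f = f"
  using Ident_Comp[of f "Dom C f" B] by (simp add: hom_def)

lemma Comp_assoc_right [simp]:
  assumes "f \<in> Arr C" "g \<in> Arr C" "h \<in> Arr C" "Cod C f = Dom C g" "Cod C g = Dom C h"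
  shows "(h \<cdot> g) \<cdot> f = h \<cdot> g \<cdot> f"
  using Comp_assoc[of f "Dom C f" "Cod C f" g "Cod C g" h "Cod C h"] assms by (simp add: hom_def)

lemma Dom_Cod_in_Obj [simp]: "f \<in> Arr C \<Longrightarrow> Dom C f \<in> Obj C" "f \<in> Arr C \<Longrightarrow> Cod C f \<in> Obj C"
  by (rule Dom_in_Obj Cod_in_Obj, assumption)+

end

lemma category_full_subcategory:
  fixes D :: "('p, 'n) category"
  assumes "category D"
  shows "category (full_subcategory D P)"
proof -
  interpret D: category D by (rule assms)
  show ?thesis
    by unfold_locales (auto simp: full_subcategory_def hom_def)
qed

context cartesian_monoidal_category
begin

lemma Prod_Obj [simp]: "A \<in> Obj C \<Longrightarrow> B \<in> Obj C \<Longrightarrow> A \<otimes> B \<in> Obj C"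
  by (rule Prod_in_Obj)

lemma Proj_type [simp]:
  assumes "A \<in> Obj C" "B \<in> Obj C"
  shows "\<pi>\<^sub>1 A B \<in> Arr C" "Dom C (\<pi>\<^sub>1 A B) = A \<otimes> B" "Cod C (\<pi>\<^sub>1 A B) = A"
    "\<pi>\<^sub>2 A B \<in> Arr C" "Dom C (\<pi>\<^sub>2 A B) = A \<otimes> B" "Cod C (\<pi>\<^sub>2 A B) = B"
  using Proj1_in_hom[OF assms] Proj2_in_hom[OF assms] by (auto simp: hom_def)

lemma Pairing_properties:
  assumes "f \<in> Arr C" "g \<in> Arr C" "Dom C f = Dom C g"
  shows "\<langle>f, g\<rangle> \<in> hom C (Dom C f) (Cod C f \<otimes> Cod C g) \<and>
    \<pi>\<^sub>1 (Cod C f) (Cod C g) \<cdot> \<langle>f, g\<rangle> = f \<and> \<pi>\<^sub>2 (Cod C f) (Cod C g) \<cdot> \<langle>f, g\<rangle> = g"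
  unfolding Pairing_def
  by (rule theI', rule Prod_universal) (use assms in \<open>auto simp: hom_def\<close>)

lemma Pairing_type [simp]:
  assumes "f \<in> Arr C" "g \<in> Arr C" "Dom C f = Dom C g"
  shows "\<langle>f, g\<rangle> \<in> Arr C" "Dom C \<langle>f, g\<rangle> = Dom C g" "Cod C \<langle>f, g\<rangle> = Cod C f \<otimes> Cod C g"
  using Pairing_properties[OF assms] assms by (auto simp: hom_def)

lemma Proj_Pairing [simp]:
  assumes "f \<in> Arr C" "g \<in> Arr C" "Dom C f = Dom C g" "Cod C f = A" "Cod C g = B"
  shows "\<pi>\<^sub>1 A B \<cdot> \<langle>f, g\<rangle> = f" "\<pi>\<^sub>2 A B \<cdot> \<langle>f, g\<rangle> = g"
  using Pairing_properties[OF assms(1-3)] assms(4,5) by auto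

lemma arrow_into_Prod_eqI:
  assumes "h \<in> hom C Z (A \<otimes> B)" "k \<in> hom C Z (A \<otimes> B)" "A \<in> Obj C" "B \<in> Obj C"
    and "\<pi>\<^sub>1 A B \<cdot> h = \<pi>\<^sub>1 A B \<cdot> k" "\<pi>\<^sub>2 A B \<cdot> h = \<pi>\<^sub>2 A B \<cdot> k"
  shows "h = k"
proof -
  have "\<exists>!l. l \<in> hom C Z (A \<otimes> B) \<and> \<pi>\<^sub>1 A B \<cdot> l = \<pi>\<^sub>1 A B \<cdot> k \<and> \<pi>\<^sub>2 A B \<cdot> l = \<pi>\<^sub>2 A B \<cdot> k"
    by (rule Prod_universal) (use assms in \<open>auto simp: hom_def\<close>)
  then show ?thesis using assms by metis
qed

lemma Pairing_Comp [simp]: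
  assumes "f \<in> Arr C" "g \<in> Arr C" "h \<in> Arr C" "Dom C f = Dom C g" "Cod C h = Dom C g"
  shows "\<langle>f, g\<rangle> \<cdot> h = \<langle>f \<cdot> h, g \<cdot> h\<rangle>"
  by (rule arrow_into_Prod_eqI[of _ "Dom C h" "Cod C f" "Cod C g"])
    (use assms in \<open>auto simp: hom_def Comp_assoc_right[symmetric] simp del: Comp_assoc_right\<close>)

lemma Pairing_Proj [simp]:
  assumes "A \<in> Obj C" "B \<in> Obj C"
  shows "\<langle>\<pi>\<^sub>1 A B, \<pi>\<^sub>2 A B\<rangle> = Ident C (A \<otimes> B)"
  by (rule arrow_into_Prod_eqI[of _ "A \<otimes> B" A B]) (use assms in \<open>auto simp: hom_def\<close>)

lemma Tensor_type [simp]: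
  assumes "f \<in> Arr C" "g \<in> Arr C"
  shows "f \<boxtimes> g \<in> Arr C" "Dom C (f \<boxtimes> g) = Dom C f \<otimes> Dom C g"
    "Cod C (f \<boxtimes> g) = Cod C f \<otimes> Cod C g"
  using assms by (simp_all add: Tensor_def)

lemma Tensor_Pairing [simp]:
  assumes "f \<in> Arr C" "g \<in> Arr C" "h \<in> Arr C" "k \<in> Arr C"
    "Dom C h = Dom C k" "Cod C h = Dom C f" "Cod C k = Dom C g"
  shows "(f \<boxtimes> g) \<cdot> \<langle>h, k\<rangle> = \<langle>f \<cdot> h, g \<cdot> k\<rangle>"
  using assms by (simp add: Tensor_def)

lemma Swap_type [simp]:
  assumes "X \<in> Obj C"
  shows "\<tau> X \<in> Arr C" "Dom C (\<tau> X) = X \<otimes> X" "Cod C (\<tau> X) = X \<otimes> X"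
  using assms by (simp_all add: Swap_def)

lemma Swap_Pairing [simp]:
  assumes "x \<in> Arr C" "y \<in> Arr C" "Dom C x = Dom C y" "Cod C x = X" "Cod C y = X"
  shows "\<tau> X \<cdot> \<langle>x, y\<rangle> = \<langle>y, x\<rangle>"
  using assms by (auto simp: Swap_def)

lemma Assoc_type [simp]:
  assumes "X \<in> Obj C"
  shows "\<alpha> X \<in> Arr C" "Dom C (\<alpha> X) = (X \<otimes> X) \<otimes> X" "Cod C (\<alpha> X) = X \<otimes> X \<otimes> X"
    "\<alpha>' X \<in> Arr C" "Dom C (\<alpha>' X) = X \<otimes> X \<otimes> X" "Cod C (\<alpha>' X) = (X \<otimes> X) \<otimes> X"
  using assms by (simp_all add: Assoc_def Assoc_inv_def)

lemma Assoc_Pairing [simp]: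
  assumes "x \<in> Arr C" "y \<in> Arr C" "z \<in> Arr C" "Dom C x = Dom C z" "Dom C y = Dom C z"
    "Cod C x = X" "Cod C y = X" "Cod C z = X"
  shows "\<alpha> X \<cdot> \<langle>\<langle>x, y\<rangle>, z\<rangle> = \<langle>x, \<langle>y, z\<rangle>\<rangle>" "\<alpha>' X \<cdot> \<langle>x, \<langle>y, z\<rangle>\<rangle> = \<langle>\<langle>x, y\<rangle>, z\<rangle>"
  using assms by (auto simp: Assoc_def Assoc_inv_def)

text \<open>
  It suffices to test arrows on generalized elements because the tuple of projections, the
  identity, is itself one. These two rules turn equations between arrows into identities in
  variables.
\<close>

lemma arrow_from_square_eqI:
  assumes "f \<in> hom C (X \<otimes> X) A" "g \<in> hom C (X \<otimes> X) A" "X \<in> Obj C"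
    and "\<And>Z x y. x \<in> hom C Z X \<Longrightarrow> y \<in> hom C Z X \<Longrightarrow> f \<cdot> \<langle>x, y\<rangle> = g \<cdot> \<langle>x, y\<rangle>"
  shows "f = g"
  using assms(1-3) assms(4)[of "\<pi>\<^sub>1 X X" "X \<otimes> X" "\<pi>\<^sub>2 X X"] by (simp add: hom_def)

lemma arrow_from_cube_eqI:
  assumes "f \<in> hom C ((X \<otimes> X) \<otimes> X) A" "g \<in> hom C ((X \<otimes> X) \<otimes> X) A" "X \<in> Obj C"
    and "\<And>Z x y z. x \<in> hom C Z X \<Longrightarrow> y \<in> hom C Z X \<Longrightarrow> z \<in> hom C Z X \<Longrightarrow>
      f \<cdot> \<langle>\<langle>x, y\<rangle>, z\<rangle> = g \<cdot> \<langle>\<langle>x, y\<rangle>, z\<rangle>"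
  shows "f = g"
proof -
  let ?p = "\<pi>\<^sub>1 (X \<otimes> X) X"
  have "\<langle>\<pi>\<^sub>1 X X \<cdot> ?p, \<pi>\<^sub>2 X X \<cdot> ?p\<rangle> = \<langle>\<pi>\<^sub>1 X X, \<pi>\<^sub>2 X X\<rangle> \<cdot> ?p"
    using assms(3) by (simp del: Pairing_Proj)
  then have "\<langle>\<pi>\<^sub>1 X X \<cdot> ?p, \<pi>\<^sub>2 X X \<cdot> ?p\<rangle> = ?p"
    using assms(3) by simp
  then show ?thesis
    using assms(1-3)
      assms(4)[of "\<pi>\<^sub>1 X X \<cdot> ?p" "(X \<otimes> X) \<otimes> X" "\<pi>\<^sub>2 X X \<cdot> ?p" "\<pi>\<^sub>2 (X \<otimes> X) X"]
    by (simp add: hom_def)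
qed

lemma Tensor_Ident:
  assumes "X \<in> Obj C"
  shows "Ident C X \<boxtimes> Ident C X = Ident C (X \<otimes> X)"
  using assms by (simp add: Tensor_def)

lemma Tensor_Comp:
  assumes "f \<in> Arr C" "g \<in> Arr C" "Cod C f = Dom C g"
    and "f' \<in> Arr C" "g' \<in> Arr C" "Cod C f' = Dom C g'"
  shows "(g \<cdot> f) \<boxtimes> (g' \<cdot> f') = (g \<boxtimes> g') \<cdot> (f \<boxtimes> f')"
  using assms by (simp add: Tensor_def[of C f f'] Tensor_def[of C "g \<cdot> f"])

end

section \<open>Categories of racks and of Yang--Baxter operators\<close>

text \<open>
  Functoriality of the tensor square lets homomorphisms of magma objects compose. It serves for
  \<open>\<triangleright>\<close> and for \<open>\<triangleright>\<^sup>-\<^sup>1\<close> alike.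
\<close>

lemma (in cartesian_monoidal_category) intertwining_Comp:
  assumes "\<phi> \<in> hom C X Y" "\<psi> \<in> hom C Y Z"
    and "t \<in> hom C (X \<otimes> X) X" "t' \<in> hom C (Y \<otimes> Y) Y" "t'' \<in> hom C (Z \<otimes> Z) Z"
    and "\<phi> \<cdot> t = t' \<cdot> (\<phi> \<boxtimes> \<phi>)" "\<psi> \<cdot> t' = t'' \<cdot> (\<psi> \<boxtimes> \<psi>)"
  shows "(\<psi> \<cdot> \<phi>) \<cdot> t = t'' \<cdot> ((\<psi> \<cdot> \<phi>) \<boxtimes> (\<psi> \<cdot> \<phi>))"
proof -
  have "(\<psi> \<cdot> \<phi>) \<cdot> t = (\<psi> \<cdot> t') \<cdot> (\<phi> \<boxtimes> \<phi>)"
    using assms(1-6) by (simp add: hom_def)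
  also have "\<dots> = t'' \<cdot> (\<psi> \<boxtimes> \<psi>) \<cdot> (\<phi> \<boxtimes> \<phi>)"
    using assms(1-5,7) by (simp add: hom_def)
  finally show ?thesis
    using assms(1,2) by (simp add: hom_def Tensor_Comp)
qed

lemma rack_morphism_Ident:
  assumes "rack_object C X t u"
  shows "rack_morphism C X t u X t u (Ident C X)"
proof -
  interpret rack_object C X t u by (rule assms)
  show ?thesis
    by unfold_locales
      (use carrier_in_Obj t_in_hom u_in_hom in \<open>auto simp: hom_def Tensor_Ident\<close>)
qed

lemma rack_morphism_Comp:
  assumes "rack_morphism C X t u Y t' u' \<phi>" "rack_morphism C Y t' u' Z t'' u'' \<psi>"
  shows "rack_morphism C X t u Z t'' u'' (\<psi> \<cdot>\<^bsub>C\<^esub> \<phi>)"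
proof -
  interpret f: rack_morphism C X t u Y t' u' \<phi> by (rule assms)
  interpret g: rack_morphism C Y t' u' Z t'' u'' \<psi> by (rule assms)
  show ?thesis
    by unfold_locales
      (use f.\<phi>_in_hom g.\<phi>_in_hom f.source.t_in_hom f.source.u_in_hom f.target.t_in_hom
        f.target.u_in_hom g.target.t_in_hom g.target.u_in_hom f.\<phi>_t f.\<phi>_u g.\<phi>_t g.\<phi>_u in
        \<open>auto intro: f.source.intertwining_Comp f.source.Comp_in_hom\<close>)
qed

lemma rack_morphism_typeD:
  assumes "rack_morphism C X t u Y t' u' \<phi>"
  shows "rack_object C X t u" "rack_object C Y t' u'" "\<phi> \<in> hom C X Y"
  using assms unfolding rack_morphism_def rack_morphism_axioms_def by auto

lemma category_Rack:
  assumes "cartesian_monoidal_category C"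
  shows "category (Rack C)"
proof -
  interpret cartesian_monoidal_category C by (rule assms)
  show ?thesis
  proof
    fix f A B g D h E
    assume "f \<in> hom (Rack C) A B" "g \<in> hom (Rack C) B D" "h \<in> hom (Rack C) D E"
    then show "(h \<cdot>\<^bsub>Rack C\<^esub> g) \<cdot>\<^bsub>Rack C\<^esub> f = h \<cdot>\<^bsub>Rack C\<^esub> g \<cdot>\<^bsub>Rack C\<^esub> f"
      by (auto simp: hom_def Rack_def dest!: rack_morphism_typeD(3))
  qed (auto simp: hom_def Rack_def
      intro: rack_morphism_Ident rack_morphism_Comp
      dest: rack_morphism_typeD)
qed

lemma yang_baxter_morphism_typeD:
  assumes "yang_baxter_morphism C X r Y s \<phi>"
  shows "yang_baxter_operator C X r" "yang_baxter_operator C Y s" "\<phi> \<in> hom C X Y"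
  using assms unfolding yang_baxter_morphism_def yang_baxter_morphism_axioms_def by auto

lemma (in yang_baxter_operator) r_in_hom: "r \<in> hom C (X \<otimes> X) (X \<otimes> X)"
  using r_in_Aut by (simp add: Aut_def)

lemma yang_baxter_morphism_Ident:
  assumes "yang_baxter_operator C X r"
  shows "yang_baxter_morphism C X r X r (Ident C X)"
proof -
  interpret yang_baxter_operator C X r by (rule assms)
  show ?thesis
    by unfold_locales
      (use carrier_in_Obj r_in_hom in \<open>auto simp: hom_def Tensor_Ident\<close>)
qed

lemma yang_baxter_morphism_Comp:
  assumes "yang_baxter_morphism C X r Y s \<phi>" "yang_baxter_morphism C Y s Z q \<psi>"
  shows "yang_baxter_morphism C X r Z q (\<psi> \<cdot>\<^bsub>C\<^esub> \<phi>)"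
proof -
  interpret f: yang_baxter_morphism C X r Y s \<phi> by (rule assms)
  interpret g: yang_baxter_morphism C Y s Z q \<psi> by (rule assms)
  note types = f.\<phi>_in_hom g.\<phi>_in_hom f.source.r_in_hom f.target.r_in_hom g.target.r_in_hom
  show ?thesis
  proof
    show "\<psi> \<cdot>\<^bsub>C\<^esub> \<phi> \<in> hom C X Z"
      using types by (auto intro: f.source.Comp_in_hom)
    have "((\<psi> \<boxtimes>\<^bsub>C\<^esub> \<psi>) \<cdot>\<^bsub>C\<^esub> (\<phi> \<boxtimes>\<^bsub>C\<^esub> \<phi>)) \<cdot>\<^bsub>C\<^esub> r =
        ((\<psi> \<boxtimes>\<^bsub>C\<^esub> \<psi>) \<cdot>\<^bsub>C\<^esub> s) \<cdot>\<^bsub>C\<^esub> (\<phi> \<boxtimes>\<^bsub>C\<^esub> \<phi>)"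
      using types f.\<phi>_r by (simp add: hom_def)
    also have "\<dots> = q \<cdot>\<^bsub>C\<^esub> (\<psi> \<boxtimes>\<^bsub>C\<^esub> \<psi>) \<cdot>\<^bsub>C\<^esub> (\<phi> \<boxtimes>\<^bsub>C\<^esub> \<phi>)"
      using types g.\<phi>_r by (simp add: hom_def)
    finally show "((\<psi> \<cdot>\<^bsub>C\<^esub> \<phi>) \<boxtimes>\<^bsub>C\<^esub> (\<psi> \<cdot>\<^bsub>C\<^esub> \<phi>)) \<cdot>\<^bsub>C\<^esub> r =
        q \<cdot>\<^bsub>C\<^esub> ((\<psi> \<cdot>\<^bsub>C\<^esub> \<phi>) \<boxtimes>\<^bsub>C\<^esub> (\<psi> \<cdot>\<^bsub>C\<^esub> \<phi>))"
      using types by (simp add: hom_def f.source.Tensor_Comp)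
  qed
qed

lemma category_YB:
  assumes "cartesian_monoidal_category C"
  shows "category (YB C)"
proof -
  interpret cartesian_monoidal_category C by (rule assms)
  show ?thesis
  proof
    fix f A B g D h E
    assume "f \<in> hom (YB C) A B" "g \<in> hom (YB C) B D" "h \<in> hom (YB C) D E"
    then show "(h \<cdot>\<^bsub>YB C\<^esub> g) \<cdot>\<^bsub>YB C\<^esub> f = h \<cdot>\<^bsub>YB C\<^esub> g \<cdot>\<^bsub>YB C\<^esub> f"
      by (auto simp: hom_def YB_def dest!: yang_baxter_morphism_typeD(3))
  qed (auto simp: hom_def YB_def
      intro: yang_baxter_morphism_Ident yang_baxter_morphism_Comp
      dest: yang_baxter_morphism_typeD)
qed

section \<open>The Yang--Baxter operator of a rack\<close>

context rack_object
begin

text \<open>On elements, \<open>r(x, y) = (y, y \<triangleright> x)\<close>.\<close>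

definition braiding :: 'm where
  "braiding = \<langle>\<pi>\<^sub>1 X X, t\<rangle> \<cdot> \<tau> X"

lemma operations_type [simp]:
  "t \<in> Arr C" "Dom C t = X \<otimes> X" "Cod C t = X" "u \<in> Arr C" "Dom C u = X \<otimes> X" "Cod C u = X"
  "X \<in> Obj C"
  using t_in_hom u_in_hom carrier_in_Obj by (auto simp: hom_def)

lemma u_t_cancel:
  assumes "x \<in> hom C Z X" "y \<in> hom C Z X"
  shows "u \<cdot> \<langle>t \<cdot> \<langle>x, y\<rangle>, x\<rangle> = y"
proof -
  have "\<pi>\<^sub>2 X X \<cdot> (\<langle>\<pi>\<^sub>2 X X, u\<rangle> \<cdot> \<langle>t, \<pi>\<^sub>1 X X\<rangle>) \<cdot> \<langle>x, y\<rangle> = \<pi>\<^sub>2 X X \<cdot> Ident C (X \<otimes> X) \<cdot> \<langle>x, y\<rangle>"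
    using mutually_inverse by (simp add: inverse_arrows_def del: Pairing_Comp)
  then show ?thesis using assms by (simp add: hom_def)
qed

lemma t_u_cancel:
  assumes "x \<in> hom C Z X" "y \<in> hom C Z X"
  shows "t \<cdot> \<langle>y, u \<cdot> \<langle>x, y\<rangle>\<rangle> = x"
proof -
  have "\<pi>\<^sub>1 X X \<cdot> (\<langle>t, \<pi>\<^sub>1 X X\<rangle> \<cdot> \<langle>\<pi>\<^sub>2 X X, u\<rangle>) \<cdot> \<langle>x, y\<rangle> = \<pi>\<^sub>1 X X \<cdot> Ident C (X \<otimes> X) \<cdot> \<langle>x, y\<rangle>"
    using mutually_inverse by (simp add: inverse_arrows_def del: Pairing_Comp)
  then show ?thesis using assms by (simp add: hom_def)
qed

lemma self_distributive:
  assumes "x \<in> hom C Z X" "y \<in> hom C Z X" "z \<in> hom C Z X"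
  shows "t \<cdot> \<langle>x, t \<cdot> \<langle>y, z\<rangle>\<rangle> = t \<cdot> \<langle>t \<cdot> \<langle>x, y\<rangle>, t \<cdot> \<langle>x, z\<rangle>\<rangle>"
proof -
  have "(t \<cdot> (Ident C X \<boxtimes> t) \<cdot> \<alpha> X) \<cdot> \<langle>\<langle>x, y\<rangle>, z\<rangle> =
      (t \<cdot> (Ident C X \<boxtimes> t) \<cdot> \<alpha> X \<cdot> (\<langle>t, \<pi>\<^sub>1 X X\<rangle> \<boxtimes> Ident C X)) \<cdot> \<langle>\<langle>x, y\<rangle>, z\<rangle>"
    by (simp only: t_self_distributive)
  then show ?thesis using assms by (simp add: hom_def)
qed

lemma braiding_type [simp]:
  "braiding \<in> Arr C" "Dom C braiding = X \<otimes> X" "Cod C braiding = X \<otimes> X"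
  by (simp_all add: braiding_def)

lemma braiding_Pairing [simp]:
  assumes "x \<in> Arr C" "y \<in> Arr C" "Dom C x = Dom C y" "Cod C x = X" "Cod C y = X"
  shows "braiding \<cdot> \<langle>x, y\<rangle> = \<langle>y, t \<cdot> \<langle>y, x\<rangle>\<rangle>"
  using assms by (auto simp: braiding_def)

text \<open>The inverse sends \<open>(x, y)\<close> to \<open>(y \<triangleright>\<^sup>-\<^sup>1 x, x)\<close>.\<close>

lemma invertible_braiding: "invertible C braiding"
proof -
  let ?s = "\<langle>u \<cdot> \<tau> X, \<pi>\<^sub>1 X X\<rangle>"
  have "?s \<cdot> braiding = Ident C (X \<otimes> X)"
    by (rule arrow_from_square_eqI[of _ X "X \<otimes> X"])
      (auto simp: hom_def u_t_cancel[unfolded hom_def, simplified])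
  moreover have "braiding \<cdot> ?s = Ident C (X \<otimes> X)"
    by (rule arrow_from_square_eqI[of _ X "X \<otimes> X"])
      (auto simp: hom_def t_u_cancel[unfolded hom_def, simplified])
  ultimately have "inverse_arrows C braiding ?s"
    by (simp add: inverse_arrows_def hom_def del: Pairing_Comp)
  then show ?thesis by (auto simp: invertible_def)
qed

text \<open>
  Applied to \<open>(x, y, z)\<close>, the two sides of the braid relation are \<open>(z, z \<triangleright> y, z \<triangleright> (y \<triangleright> x))\<close> and
  \<open>(z, z \<triangleright> y, (z \<triangleright> y) \<triangleright> (z \<triangleright> x))\<close>, so the relation is exactly self-distributivity.
\<close>

lemma yang_baxter_operator_braiding: "yang_baxter_operator C X braiding"
proof unfold_locales
  show "X \<in> Obj C" by simp
  show "braiding \<in> Aut C (X \<otimes> X)"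
    using invertible_braiding by (simp add: Aut_def hom_def)
  show "(braiding \<boxtimes> Ident C X) \<cdot> (\<alpha>' X \<cdot> (Ident C X \<boxtimes> braiding) \<cdot> \<alpha> X) \<cdot> (braiding \<boxtimes> Ident C X) =
    (\<alpha>' X \<cdot> (Ident C X \<boxtimes> braiding) \<cdot> \<alpha> X) \<cdot> (braiding \<boxtimes> Ident C X) \<cdot>
      (\<alpha>' X \<cdot> (Ident C X \<boxtimes> braiding) \<cdot> \<alpha> X)"
  proof (rule arrow_from_cube_eqI[of _ X "(X \<otimes> X) \<otimes> X"])
    fix Z x y z
    assume xyz: "x \<in> hom C Z X" "y \<in> hom C Z X" "z \<in> hom C Z X"
    show "((braiding \<boxtimes> Ident C X) \<cdot> (\<alpha>' X \<cdot> (Ident C X \<boxtimes> braiding) \<cdot> \<alpha> X) \<cdot>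
        (braiding \<boxtimes> Ident C X)) \<cdot> \<langle>\<langle>x, y\<rangle>, z\<rangle> =
      ((\<alpha>' X \<cdot> (Ident C X \<boxtimes> braiding) \<cdot> \<alpha> X) \<cdot> (braiding \<boxtimes> Ident C X) \<cdot>
        (\<alpha>' X \<cdot> (Ident C X \<boxtimes> braiding) \<cdot> \<alpha> X)) \<cdot> \<langle>\<langle>x, y\<rangle>, z\<rangle>"
      using self_distributive[OF xyz(3,2,1)] xyz by (simp add: hom_def)
  qed (simp_all add: hom_def)
qed

text \<open>
  The first map is the identity. The second is \<open>(x, y) \<mapsto> (y \<triangleright> x, y)\<close>, which is undone by
  \<open>(x, y) \<mapsto> (x \<triangleright>\<^sup>-\<^sup>1 y, y)\<close>.
\<close>

lemma nondegenerate_braiding: "nondegenerate C X braiding"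
proof -
  have "\<langle>\<pi>\<^sub>1 X X, \<pi>\<^sub>1 X X \<cdot> braiding\<rangle> = Ident C (X \<otimes> X)"
    by (simp add: braiding_def Swap_def)
  then have id: "inverse_arrows C \<langle>\<pi>\<^sub>1 X X, \<pi>\<^sub>1 X X \<cdot> braiding\<rangle> (Ident C (X \<otimes> X))"
    by (simp add: inverse_arrows_def hom_def)
  let ?q = "\<langle>\<pi>\<^sub>2 X X \<cdot> braiding, \<pi>\<^sub>2 X X\<rangle>" and ?s = "\<langle>u, \<pi>\<^sub>2 X X\<rangle>"
  have "?s \<cdot> ?q = Ident C (X \<otimes> X)"
    by (rule arrow_from_square_eqI[of _ X "X \<otimes> X"])
      (auto simp: hom_def u_t_cancel[unfolded hom_def, simplified])
  moreover have "?q \<cdot> ?s = Ident C (X \<otimes> X)"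
    by (rule arrow_from_square_eqI[of _ X "X \<otimes> X"])
      (auto simp: hom_def t_u_cancel[unfolded hom_def, simplified])
  ultimately have "inverse_arrows C ?q ?s"
    by (simp add: inverse_arrows_def hom_def del: Pairing_Comp)
  with id show ?thesis
    unfolding nondegenerate_def invertible_def by blast
qed

end

section \<open>Rack morphisms are the morphisms of the associated operators\<close>

text \<open>
  The second component of the intertwining equation says that \<open>\<phi>\<close> preserves \<open>\<triangleright>\<close>; the
  first component holds for every \<open>\<phi>\<close>. Preservation of \<open>\<triangleright>\<^sup>-\<^sup>1\<close> then follows by solving an
  equation: for \<open>a = x \<triangleright>\<^sup>-\<^sup>1 y\<close> one has \<open>y \<triangleright> a = x\<close>, so \<open>\<phi> y \<triangleright> \<phi> a = \<phi> x\<close>, that is,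
  \<open>\<phi> a = \<phi> x \<triangleright>\<^sup>-\<^sup>1 \<phi> y\<close>.
\<close>

lemma rack_morphism_iff_yang_baxter_morphism:
  assumes "rack_object C X t u" "rack_object C Y t' u'"
  shows "rack_morphism C X t u Y t' u' \<phi> \<longleftrightarrow>
    yang_baxter_morphism C X (rack_object.braiding C X t) Y (rack_object.braiding C Y t') \<phi>"
    (is "?R \<longleftrightarrow> ?Y")
proof
  interpret X: rack_object C X t u by (rule assms)
  interpret Y: rack_object C Y t' u' by (rule assms)
  {
    assume ?R
    then interpret f: rack_morphism C X t u Y t' u' \<phi> .
    interpret rX: yang_baxter_operator C X X.braiding by (rule X.yang_baxter_operator_braiding)
    interpret rY: yang_baxter_operator C Y Y.braiding by (rule Y.yang_baxter_operator_braiding)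
    note \<phi> = f.\<phi>_in_hom
    show ?Y
    proof unfold_locales
      show "(\<phi> \<boxtimes>\<^bsub>C\<^esub> \<phi>) \<cdot>\<^bsub>C\<^esub> X.braiding = Y.braiding \<cdot>\<^bsub>C\<^esub> (\<phi> \<boxtimes>\<^bsub>C\<^esub> \<phi>)"
      proof (rule X.arrow_from_square_eqI[of _ X "Y \<otimes>\<^bsub>C\<^esub> Y"])
        fix Z x y
        assume xy: "x \<in> hom C Z X" "y \<in> hom C Z X"
        have "(\<phi> \<cdot>\<^bsub>C\<^esub> t) \<cdot>\<^bsub>C\<^esub> \<langle>y, x\<rangle>\<^bsub>C\<^esub> = (t' \<cdot>\<^bsub>C\<^esub> (\<phi> \<boxtimes>\<^bsub>C\<^esub> \<phi>)) \<cdot>\<^bsub>C\<^esub> \<langle>y, x\<rangle>\<^bsub>C\<^esub>"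
          by (simp only: f.\<phi>_t)
        then show "((\<phi> \<boxtimes>\<^bsub>C\<^esub> \<phi>) \<cdot>\<^bsub>C\<^esub> X.braiding) \<cdot>\<^bsub>C\<^esub> \<langle>x, y\<rangle>\<^bsub>C\<^esub> =
            (Y.braiding \<cdot>\<^bsub>C\<^esub> (\<phi> \<boxtimes>\<^bsub>C\<^esub> \<phi>)) \<cdot>\<^bsub>C\<^esub> \<langle>x, y\<rangle>\<^bsub>C\<^esub>"
          using xy \<phi> by (simp add: hom_def)
      qed (use \<phi> in \<open>simp_all add: hom_def\<close>)
    qed (rule \<phi>)
  }
  {
    assume ?Y
    then interpret f: yang_baxter_morphism C X X.braiding Y Y.braiding \<phi> .
    note \<phi> = f.\<phi>_in_hom
    have preserves: "\<phi> \<cdot>\<^bsub>C\<^esub> t \<cdot>\<^bsub>C\<^esub> \<langle>x, y\<rangle>\<^bsub>C\<^esub> = t' \<cdot>\<^bsub>C\<^esub> \<langle>\<phi> \<cdot>\<^bsub>C\<^esub> x, \<phi> \<cdot>\<^bsub>C\<^esub> y\<rangle>\<^bsub>C\<^esub>"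
      if xy: "x \<in> hom C Z X" "y \<in> hom C Z X" for Z x y
    proof -
      have "\<pi>\<^sub>2\<^bsub>C\<^esub> Y Y \<cdot>\<^bsub>C\<^esub> ((\<phi> \<boxtimes>\<^bsub>C\<^esub> \<phi>) \<cdot>\<^bsub>C\<^esub> X.braiding) \<cdot>\<^bsub>C\<^esub> \<langle>y, x\<rangle>\<^bsub>C\<^esub> =
          \<pi>\<^sub>2\<^bsub>C\<^esub> Y Y \<cdot>\<^bsub>C\<^esub> (Y.braiding \<cdot>\<^bsub>C\<^esub> (\<phi> \<boxtimes>\<^bsub>C\<^esub> \<phi>)) \<cdot>\<^bsub>C\<^esub> \<langle>y, x\<rangle>\<^bsub>C\<^esub>"
        by (simp only: f.\<phi>_r)
      then show ?thesis using xy \<phi> by (simp add: hom_def)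
    qed
    show ?R
    proof unfold_locales
      show "\<phi> \<in> hom C X Y" by (rule \<phi>)
      show "\<phi> \<cdot>\<^bsub>C\<^esub> t = t' \<cdot>\<^bsub>C\<^esub> (\<phi> \<boxtimes>\<^bsub>C\<^esub> \<phi>)"
        by (rule X.arrow_from_square_eqI[of _ X Y])
          (use \<phi> preserves in \<open>auto simp: hom_def\<close>)
      show "\<phi> \<cdot>\<^bsub>C\<^esub> u = u' \<cdot>\<^bsub>C\<^esub> (\<phi> \<boxtimes>\<^bsub>C\<^esub> \<phi>)"
      proof (rule X.arrow_from_square_eqI[of _ X Y])
        fix Z x y
        assume xy: "x \<in> hom C Z X" "y \<in> hom C Z X"
        let ?a = "u \<cdot>\<^bsub>C\<^esub> \<langle>x, y\<rangle>\<^bsub>C\<^esub>"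
        have a: "?a \<in> hom C Z X" using xy by (simp add: hom_def)
        have "t' \<cdot>\<^bsub>C\<^esub> \<langle>\<phi> \<cdot>\<^bsub>C\<^esub> y, \<phi> \<cdot>\<^bsub>C\<^esub> ?a\<rangle>\<^bsub>C\<^esub> = \<phi> \<cdot>\<^bsub>C\<^esub> x"
          using preserves[OF xy(2) a] X.t_u_cancel[OF xy] by simp
        then have "u' \<cdot>\<^bsub>C\<^esub> \<langle>\<phi> \<cdot>\<^bsub>C\<^esub> x, \<phi> \<cdot>\<^bsub>C\<^esub> y\<rangle>\<^bsub>C\<^esub> = \<phi> \<cdot>\<^bsub>C\<^esub> ?a"
          using Y.u_t_cancel[OF X.Comp_in_hom[OF xy(2) \<phi>] X.Comp_in_hom[OF a \<phi>]] by simp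
        then show "(\<phi> \<cdot>\<^bsub>C\<^esub> u) \<cdot>\<^bsub>C\<^esub> \<langle>x, y\<rangle>\<^bsub>C\<^esub> = (u' \<cdot>\<^bsub>C\<^esub> (\<phi> \<boxtimes>\<^bsub>C\<^esub> \<phi>)) \<cdot>\<^bsub>C\<^esub> \<langle>x, y\<rangle>\<^bsub>C\<^esub>"
          using xy \<phi> by (simp add: hom_def)
      qed (use \<phi> in \<open>simp_all add: hom_def\<close>)
    qed
  }
qed

section \<open>The functor from racks to Yang--Baxter operators\<close>

lemma F_obj_eq_braiding:
  assumes "rack_object C X t u"
  shows "F_obj C (X, t, u) = (X, rack_object.braiding C X t)"
  by (simp add: F_obj_def rack_object.braiding_def[OF assms])

lemma Rack_hom_iff:
  "((X, t, u), \<phi>, (Y, t', u')) \<in> hom (Rack C) A B \<longleftrightarrow>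
    rack_morphism C X t u Y t' u' \<phi> \<and> A = (X, t, u) \<and> B = (Y, t', u')"
  by (auto simp: hom_def Rack_def)

lemma YB_nd_hom_iff:
  "((X, r), \<phi>, (Y, s)) \<in> hom (YB_nd C) A B \<longleftrightarrow>
    yang_baxter_morphism C X r Y s \<phi> \<and> nondegenerate C X r \<and> nondegenerate C Y s \<and>
    A = (X, r) \<and> B = (Y, s)"
  by (auto simp: hom_def YB_nd_def full_subcategory_def YB_def)

theorem theorem11p1:
  fixes C :: "('o, 'm) cartesian"
  assumes "cartesian_monoidal_category C"
  shows "fully_faithful_functor (Rack C) (YB_nd C) (F_obj C) (F_arr C)"
proof -
  interpret cartesian_monoidal_category C by (rule assms)
  interpret Rack: category "Rack C" by (rule category_Rack[OF assms])
  interpret YB_nd: category "YB_nd C"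
    unfolding YB_nd_def by (rule category_full_subcategory[OF category_YB[OF assms]])
  show ?thesis
  proof
    fix A assume "A \<in> Obj (Rack C)"
    then obtain X t u where A: "A = (X, t, u)" "rack_object C X t u"
      by (auto simp: Rack_def)
    then show "F_obj C A \<in> Obj (YB_nd C)"
      by (simp add: F_obj_eq_braiding YB_nd_def full_subcategory_def YB_def
          rack_object.yang_baxter_operator_braiding rack_object.nondegenerate_braiding)
    show "F_arr C (Ident (Rack C) A) = Ident (YB_nd C) (F_obj C A)"
      using A by (simp add: F_arr_def Rack_def YB_nd_def full_subcategory_def YB_def F_obj_def)
  next
    fix f A B assume f: "f \<in> hom (Rack C) A B"
    obtain X t u \<phi> Y t' u' where f_eq: "f = ((X, t, u), \<phi>, (Y, t', u'))"
      by (cases f) auto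
    with f have "rack_morphism C X t u Y t' u' \<phi>" and AB: "A = (X, t, u)" "B = (Y, t', u')"
      by (simp_all add: Rack_hom_iff)
    moreover from this have "rack_object C X t u" "rack_object C Y t' u'"
      by (auto dest: rack_morphism_typeD)
    ultimately show "F_arr C f \<in> hom (YB_nd C) (F_obj C A) (F_obj C B)"
      by (simp add: f_eq F_arr_def F_obj_eq_braiding YB_nd_hom_iff
          rack_object.nondegenerate_braiding rack_morphism_iff_yang_baxter_morphism)
  next
    fix f A B g D assume "f \<in> hom (Rack C) A B" "g \<in> hom (Rack C) B D"
    then show "F_arr C (g \<cdot>\<^bsub>Rack C\<^esub> f) = F_arr C g \<cdot>\<^bsub>YB_nd C\<^esub> F_arr C f"
      by (auto simp: F_arr_def Rack_def YB_nd_def full_subcategory_def YB_def split: prod.splits)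
  next
    fix A B g
    assume "A \<in> Obj (Rack C)" "B \<in> Obj (Rack C)"
    then obtain X t u Y t' u' where
      AB: "A = (X, t, u)" "B = (Y, t', u')" "rack_object C X t u" "rack_object C Y t' u'"
      by (auto simp: Rack_def)
    assume g: "g \<in> hom (YB_nd C) (F_obj C A) (F_obj C B)"
    obtain X' r \<phi> Y' s where "g = ((X', r), \<phi>, (Y', s))"
      by (cases g) auto
    with g AB have g_eq: "g = (F_obj C A, \<phi>, F_obj C B)"
      and "rack_morphism C X t u Y t' u' \<phi>"
      by (auto simp: F_obj_eq_braiding YB_nd_hom_iff rack_morphism_iff_yang_baxter_morphism)
    with AB have "(A, \<phi>, B) \<in> hom (Rack C) A B" by (simp add: Rack_hom_iff)
    moreover have "F_arr C (A, \<phi>, B) = g" by (simp add: F_arr_def g_eq)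
    ultimately show "\<exists>f \<in> hom (Rack C) A B. F_arr C f = g" by blast
  next
    fix A B f f'
    assume "f \<in> hom (Rack C) A B" "f' \<in> hom (Rack C) A B" "F_arr C f = F_arr C f'"
    then show "f = f'" by (auto simp: hom_def Rack_def F_arr_def)
  qed
qed

end
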